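(* Let $d\geq 1$ be an integer. A $3$-regular map $\mathbb{R}^d\to\mathbb{R}^N$ exists if and only if $N\geq d+2$.
   Context: For a topological space $X$ and an integer $k\ge 1$, let $F(X,k)=\{(x_1,\ldots,x_k)\in X^k : x_i\neq x_j \text{ for all } i\neq j\}$. A map $f\colon X\to\mathbb{R}^N$ is called $k$-regular if it is continuous and for every $(x_1,\ldots,x_k)\in F(X,k)$ the vectors $f(x_1),\ldots,f(x_k)$ are linearly independent in $\mathbb{R}^N$. *)

theory Defs
  imports "HOL-Analysis.Analysis" "HOL-Library.Function_Algebras"
begin

text \<open>
  The Euclidean space \<open>\<real>\<^sup>n\<close> is the library's \<^const>\<open>Euclidean_space\<close>: the sequences
  \<open>nat \<Rightarrow> real\<close> that vanish at all indices \<open>\<ge> n\<close>, with coordinates numbered from 0.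
  Its dimension is a term, so it can be quantified over, and \<open>\<real>\<^sup>0\<close> is included.
\<close>

definition configuration_space :: "'a topology \<Rightarrow> nat \<Rightarrow> (nat \<Rightarrow> 'a) set" where
  "configuration_space X k =
     {x \<in> {1..k} \<rightarrow>\<^sub>E topspace X. \<forall>i\<in>{1..k}. \<forall>j\<in>{1..k}. i \<noteq> j \<longrightarrow> x i \<noteq> x j}"

text \<open>
  Linear independence of an indexed family, so that a repeated vector makes it dependent;
  \<^term>\<open>\<Sum>i\<in>I. c i * v i n\<close> is the \<open>n\<close>-th coordinate of the linear combination.
\<close>

definition lin_indep_family :: "'i set \<Rightarrow> ('i \<Rightarrow> nat \<Rightarrow> real) \<Rightarrow> bool" where
  "lin_indep_family I v \<longleftrightarrow>
     (\<forall>c. (\<forall>n. (\<Sum>i\<in>I. c i * v i n) = 0) \<longrightarrow> (\<forall>i\<in>I. c i = 0))"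

definition regular_map :: "nat \<Rightarrow> 'a topology \<Rightarrow> nat \<Rightarrow> ('a \<Rightarrow> nat \<Rightarrow> real) \<Rightarrow> bool" where
  "regular_map k X N f \<longleftrightarrow>
     continuous_map X (Euclidean_space N) f \<and>
     (\<forall>x \<in> configuration_space X k. lin_indep_family {1..k} (\<lambda>i. f (x i)))"

text \<open>Agreement with the library's linear independence of sets, for pointwise scaling.\<close>

lemma sum_fun_apply: "(\<Sum>i\<in>I. g i) n = (\<Sum>i\<in>I. g i n)"
  for g :: "'i \<Rightarrow> 'a \<Rightarrow> real"
  by (induction I rule: infinite_finite_induct) auto

lemma vector_space_pointwise: "vector_space (\<lambda>(a::real) (w::nat \<Rightarrow> real) n. a * w n)"
  by unfold_locales (auto simp: fun_eq_iff algebra_simps)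

lemma lin_indep_family_iff_independent:
  assumes "finite I"
  shows "lin_indep_family I v \<longleftrightarrow>
    inj_on v I \<and> \<not> module.dependent (\<lambda>a w n. a * w n) (v ` I)"
proof -
  interpret V: vector_space "\<lambda>(a::real) (w::nat \<Rightarrow> real) n. a * w n"
    by (rule vector_space_pointwise)
  have inj: "inj_on v I" if L: "lin_indep_family I v"
  proof (rule inj_onI, rule ccontr)
    fix p q assume pq: "p \<in> I" "q \<in> I" "v p = v q" "p \<noteq> q"
    define c where "c i = (if i = p then 1 else 0) - (if i = q then 1 else (0::real))" for i
    have "(\<Sum>i\<in>I. c i * v i n) = 0" for n
    proof -
      have "(\<Sum>i\<in>I. c i * v i n)
          = (\<Sum>i\<in>I. (if i = p then v i n else 0) - (if i = q then v i n else 0))"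
        by (rule sum.cong) (auto simp: c_def)
      also have "\<dots> = 0"
        using pq assms by (simp only: sum_subtractf sum.delta if_True diff_self)
      finally show ?thesis .
    qed
    then have "c p = 0" using L pq unfolding lin_indep_family_def by blast
    then show False using pq by (simp add: c_def)
  qed
  have dep: "V.dependent (v ` I) \<longleftrightarrow> \<not> lin_indep_family I v" if I: "inj_on v I"
  proof -
    have "V.dependent (v ` I) \<longleftrightarrow>
        (\<exists>u. (\<exists>i\<in>I. u (v i) \<noteq> 0) \<and> (\<forall>n. (\<Sum>i\<in>I. u (v i) * v i n) = 0))"
      using I assms
      by (simp add: V.dependent_finite sum.reindex fun_eq_iff sum_fun_apply)
    also have "\<dots> \<longleftrightarrow> (\<exists>c. (\<exists>i\<in>I. c i \<noteq> 0) \<and> (\<forall>n. (\<Sum>i\<in>I. c i * v i n) = 0))"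
    proof
      assume "\<exists>c. (\<exists>i\<in>I. c i \<noteq> 0) \<and> (\<forall>n. (\<Sum>i\<in>I. c i * v i n) = 0)"
      then obtain c where c: "\<exists>i\<in>I. c i \<noteq> 0" "\<forall>n. (\<Sum>i\<in>I. c i * v i n) = 0" by blast
      have "c (inv_into I v (v i)) = c i" if "i \<in> I" for i
        using that I by simp
      then show "\<exists>u. (\<exists>i\<in>I. u (v i) \<noteq> 0) \<and> (\<forall>n. (\<Sum>i\<in>I. u (v i) * v i n) = 0)"
        using c by (intro exI[of _ "c \<circ> inv_into I v"]) (auto cong: sum.cong)
    next
      assume "\<exists>u. (\<exists>i\<in>I. u (v i) \<noteq> 0) \<and> (\<forall>n. (\<Sum>i\<in>I. u (v i) * v i n) = 0)"
      then obtain u where "\<exists>i\<in>I. u (v i) \<noteq> 0" "\<forall>n. (\<Sum>i\<in>I. u (v i) * v i n) = 0" by blast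
      then show "\<exists>c. (\<exists>i\<in>I. c i \<noteq> 0) \<and> (\<forall>n. (\<Sum>i\<in>I. c i * v i n) = 0)"
        by (intro exI[of _ "\<lambda>i. u (v i)"]) simp
    qed
    finally show ?thesis
      unfolding lin_indep_family_def by blast
  qed
  from inj dep show ?thesis by blast
qed

end

theory Submission
  imports Defs "HOL-Homology.Homology"
begin

text \<open>
  Three distinct points of a paraboloid are never collinear, so \<open>x \<mapsto> (x, 1, |x|\<^sup>2)\<close> is
  \<open>3\<close>-regular. Conversely, let \<open>f\<close> be \<open>3\<close>-regular on \<open>\<real>\<^sup>d\<close>, rescaled so that it is bounded.
  By \<open>3\<close>-regularity at \<open>0\<close> and two unit vectors, the cone
  \<open>h (x, s) = |x| f (x / |x|) + s f 0\<close> is a continuous injection of \<open>\<real>\<^bsup>d+1\<^esup>\<close> into \<open>\<real>\<^sup>N\<close>.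
  If \<open>N \<le> d + 1\<close>, then its image is open by invariance of domain, so it contains
  \<open>- t f e\<close> for a unit vector \<open>e\<close> and some \<open>t > 0\<close>; this is a linear relation
  that \<open>3\<close>-regularity forbids.
\<close>

section \<open>Three-point form of 3-regularity and coordinates in Euclidean space\<close>

lemma regular_map_3_iff:
  "regular_map 3 X N f \<longleftrightarrow> continuous_map X (Euclidean_space N) f \<and>
     (\<forall>a\<in>topspace X. \<forall>b\<in>topspace X. \<forall>c\<in>topspace X. a \<noteq> b \<longrightarrow> a \<noteq> c \<longrightarrow> b \<noteq> c \<longrightarrow>
       (\<forall>p q r. (\<forall>n. p * f a n + q * f b n + r * f c n = 0) \<longrightarrow> p = 0 \<and> q = 0 \<and> r = 0))"
    (is "_ \<longleftrightarrow> _ \<and> ?indep")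
proof -
  have I: "{Suc 0..3} = {Suc 0, 2, 3}"
    by auto
  have "(\<forall>x\<in>configuration_space X 3. lin_indep_family {1..3} (\<lambda>i. f (x i))) \<longleftrightarrow> ?indep"
    (is "?L \<longleftrightarrow> _")
  proof
    assume L: ?L
    show ?indep
    proof (intro ballI impI allI)
      fix a b c p q r
      assume abc: "a \<in> topspace X" "b \<in> topspace X" "c \<in> topspace X" "a \<noteq> b" "a \<noteq> c" "b \<noteq> c"
        and rel: "\<forall>n. p * f a n + q * f b n + r * f c n = 0"
      define x where "x = (\<lambda>i\<in>{1..3::nat}. if i = 1 then a else if i = 2 then b else c)"
      define k where "k = (\<lambda>i::nat. if i = 1 then p else if i = 2 then q else r)"
      have "x \<in> configuration_space X 3"
        using abc by (auto simp: configuration_space_def x_def)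
      then have "lin_indep_family {1..3} (\<lambda>i. f (x i))"
        using L by blast
      moreover have "(\<Sum>i\<in>{1..3}. k i * f (x i) n) = 0" for n
        using rel by (simp add: I k_def x_def add.assoc)
      ultimately have "\<forall>i\<in>{1..3}. k i = 0"
        unfolding lin_indep_family_def by blast
      then show "p = 0 \<and> q = 0 \<and> r = 0"
        by (simp add: I k_def)
    qed
  next
    assume R: ?indep
    show ?L
      unfolding lin_indep_family_def
    proof (intro ballI allI impI)
      fix x k i
      assume x: "x \<in> configuration_space X 3" and i: "i \<in> {1..3::nat}"
        and rel: "\<forall>n. (\<Sum>i\<in>{1..3}. k i * f (x i) n) = 0"
      have "x 1 \<in> topspace X" "x 2 \<in> topspace X" "x 3 \<in> topspace X"
           "x 1 \<noteq> x 2" "x 1 \<noteq> x 3" "x 2 \<noteq> x 3"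
        using x by (auto simp: configuration_space_def I)
      moreover have "\<forall>n. k 1 * f (x 1) n + k 2 * f (x 2) n + k 3 * f (x 3) n = 0"
        using rel by (simp add: I add.assoc)
      ultimately have "k 1 = 0 \<and> k 2 = 0 \<and> k 3 = 0"
        using R by blast
      then show "k i = 0"
        using i by (auto simp: I)
    qed
  qed
  then show ?thesis
    by (simp add: regular_map_def)
qed

text \<open>Lets an open set of \<open>Euclidean_space n\<close> be written as the trace of an open
  set of sequences.\<close>

lemma Euclidean_space_eq_top_of_set: "Euclidean_space n = top_of_set (topspace (Euclidean_space n))"
  by (simp add: Euclidean_space_def euclidean_product_topology)

lemma continuous_map_Euclidean_space_iff_continuous_on:
  "continuous_map (Euclidean_space m) (Euclidean_space n) f \<longleftrightarrow>
     continuous_on (topspace (Euclidean_space m)) f \<and>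
     f \<in> topspace (Euclidean_space m) \<rightarrow> topspace (Euclidean_space n)"
  using cm_Euclidean_space_iff_continuous_on[of m UNIV n f] by simp

lemma continuous_on_coordinate: "continuous_on S (\<lambda>x::nat \<Rightarrow> real. x i)"
  by (rule continuous_on_subset[OF continuous_on_product_coordinates]) auto

section \<open>The paraboloid map\<close>

text \<open>Translate so that \<open>c\<close> is the origin. The affine relation becomes
  \<open>p * (a - c) = - q * (b - c)\<close>, and the quadratic one becomes
  \<open>p * A + q * B = 0\<close> for the squared distances \<open>A\<close>, \<open>B\<close> to
  \<open>c\<close>. Squaring the first and comparing forces \<open>q = - p\<close> and
  \<open>r = 0\<close> when \<open>p\<close> is nonzero, so \<open>a = b\<close>. One coefficient
  suffices, since the others follow by permuting the points.\<close>

lemma paraboloid_coefficient_zero: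
  fixes a b c :: "nat \<Rightarrow> real"
  assumes mem: "a \<in> topspace (Euclidean_space d)" "b \<in> topspace (Euclidean_space d)"
      "c \<in> topspace (Euclidean_space d)"
    and ne: "a \<noteq> b" "a \<noteq> c"
    and sum0: "p + q + r = 0"
    and lin: "\<And>i. i < d \<Longrightarrow> p * a i + q * b i + r * c i = 0"
    and quad: "p * (\<Sum>j<d. (a j)\<^sup>2) + q * (\<Sum>j<d. (b j)\<^sup>2) + r * (\<Sum>j<d. (c j)\<^sup>2) = 0"
  shows "p = 0"
proof (rule ccontr)
  assume p: "p \<noteq> 0"
  define A where "A = (\<Sum>j<d. (a j - c j)\<^sup>2)"
  define B where "B = (\<Sum>j<d. (b j - c j)\<^sup>2)"
  have r: "r = - p - q"
    using sum0 by simp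
  have lin': "p * (a i - c i) = - (q * (b i - c i))" if "i < d" for i
    using lin[OF that] by (simp add: r algebra_simps)
  have "p * A + q * B = (\<Sum>j<d. p * (a j - c j)\<^sup>2 + q * (b j - c j)\<^sup>2)"
    by (simp add: A_def B_def sum_distrib_left sum.distrib)
  also have "\<dots> = (\<Sum>j<d. p * (a j)\<^sup>2 + q * (b j)\<^sup>2 + r * (c j)\<^sup>2)"
  proof (rule sum.cong)
    fix j assume "j \<in> {..<d}"
    \<comment> \<open>As \<open>r = - p - q\<close>, the two summands differ by exactly this
      multiple of the linear relation.\<close>
    then have "2 * c j * (p * a j + q * b j + r * c j) = 0"
      using lin by simp
    then show "p * (a j - c j)\<^sup>2 + q * (b j - c j)\<^sup>2 = p * (a j)\<^sup>2 + q * (b j)\<^sup>2 + r * (c j)\<^sup>2"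
      by (simp add: r power2_eq_square algebra_simps)
  qed simp
  also have "\<dots> = 0"
    using quad by (simp add: sum.distrib sum_distrib_left)
  finally have 1: "p * A + q * B = 0" .
  have "p\<^sup>2 * A = (\<Sum>j<d. (p * (a j - c j))\<^sup>2)"
    by (simp add: A_def sum_distrib_left power_mult_distrib)
  also have "\<dots> = (\<Sum>j<d. (q * (b j - c j))\<^sup>2)"
    by (rule sum.cong) (auto simp: lin')
  also have "\<dots> = q\<^sup>2 * B"
    by (simp add: B_def sum_distrib_left power_mult_distrib)
  finally have 2: "p\<^sup>2 * A = q\<^sup>2 * B" .
  have "A \<noteq> 0"
  proof
    assume "A = 0"
    then have "\<forall>j<d. a j = c j"
      by (auto simp: A_def sum_nonneg_eq_0_iff)
    then have "a = c"
      using mem by (auto simp: topspace_Euclidean_space fun_eq_iff) (metis not_le)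
    then show False
      using ne by simp
  qed
  \<comment> \<open>Eliminates \<open>B\<close>: the right-hand side ends in
    \<open>q * (p * A + q * B) = 0\<close>, while \<open>p\<close> and \<open>A\<close> are
    nonzero.\<close>
  have "p * A * (p + q) = p\<^sup>2 * A + q * (p * A)"
    by (simp add: power2_eq_square algebra_simps)
  also have "\<dots> = q * (p * A + q * B)"
    using 2 by (simp add: power2_eq_square algebra_simps)
  finally have "p + q = 0"
    using p \<open>A \<noteq> 0\<close> 1 by simp
  then have q: "q = - p" and "r = 0"
    using r by simp_all
  have "a j = b j" if "j < d" for j
    using lin[OF that] p by (simp add: q \<open>r = 0\<close>)
  then have "a = b"
    using mem by (auto simp: topspace_Euclidean_space fun_eq_iff) (metis not_le)
  then show False
    using ne by simp
qed

text \<open>Coordinate \<open>d\<close> is the constant 1, which turns a linear relation into an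
  affine one; coordinate \<open>Suc d\<close> is the squared norm. Padding with zeros covers every
  larger \<open>N\<close>.\<close>

lemma regular_map_3_paraboloid:
  assumes "N \<ge> d + 2"
  shows "regular_map 3 (Euclidean_space d) N
    (\<lambda>x i. if i < d then x i else if i = d then 1 else if i = Suc d then \<Sum>j<d. (x j)\<^sup>2 else 0)"
    (is "regular_map _ _ _ ?f")
  unfolding regular_map_3_iff
proof (intro conjI ballI impI allI)
  have "continuous_on (topspace (Euclidean_space d)) (\<lambda>x. ?f x i)" for i
    by (cases "i < d"; cases "i = d"; cases "i = Suc d")
       (auto intro!: continuous_intros continuous_on_coordinate)
  then show "continuous_map (Euclidean_space d) (Euclidean_space N) ?f"
    using assms unfolding continuous_map_Euclidean_space_iff_continuous_on
    by (auto intro: continuous_on_coordinatewise_then_product simp: topspace_Euclidean_space)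
next
  fix a b c :: "nat \<Rightarrow> real" and p q r :: real
  assume mem: "a \<in> topspace (Euclidean_space d)" "b \<in> topspace (Euclidean_space d)"
      "c \<in> topspace (Euclidean_space d)"
    and ne: "a \<noteq> b" "a \<noteq> c" "b \<noteq> c"
    and rel: "\<forall>n. p * ?f a n + q * ?f b n + r * ?f c n = 0"
  have lin: "p * a i + q * b i + r * c i = 0" if "i < d" for i
    using spec[OF rel, of i] that by simp
  have sum0: "p + q + r = 0"
    using spec[OF rel, of d] by simp
  have quad: "p * (\<Sum>j<d. (a j)\<^sup>2) + q * (\<Sum>j<d. (b j)\<^sup>2) + r * (\<Sum>j<d. (c j)\<^sup>2) = 0"
    using spec[OF rel, of "Suc d"] by simp
  show "p = 0"
    by (rule paraboloid_coefficient_zero[OF mem ne(1,2) sum0 lin quad])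
  show "q = 0"
    by (rule paraboloid_coefficient_zero[of b d a c q p r])
       (use mem ne sum0 lin quad in \<open>auto simp: algebra_simps\<close>)
  show "r = 0"
    by (rule paraboloid_coefficient_zero[of c d a b r p q])
       (use mem ne sum0 lin quad in \<open>auto simp: algebra_simps\<close>)
qed

section \<open>Bounded factors and bounded regular maps\<close>

text \<open>\<open>G\<close> may jump where \<open>w\<close> vanishes, but there the product is
  squeezed to 0 by \<open>\<bar>w x\<bar> * B\<close>. This handles the cone on its axis, where the
  direction is discontinuous.\<close>

lemma continuous_on_mult_bounded:
  fixes w G :: "'a::topological_space \<Rightarrow> real"
  assumes w: "continuous_on S w"
    and G: "continuous_on {x \<in> S. w x \<noteq> 0} G"
    and bd: "\<And>x. x \<in> S \<Longrightarrow> \<bar>G x\<bar> \<le> B"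
  shows "continuous_on S (\<lambda>x. w x * G x)"
  unfolding continuous_on_def
proof
  fix x assume x: "x \<in> S"
  have wx: "(w \<longlongrightarrow> w x) (at x within S)"
    using w x by (auto simp: continuous_on_def)
  show "((\<lambda>x. w x * G x) \<longlongrightarrow> w x * G x) (at x within S)"
  proof (cases "w x = 0")
    case True
    have "((\<lambda>x. \<bar>w x\<bar> * B) \<longlongrightarrow> \<bar>w x\<bar> * B) (at x within S)"
      by (intro tendsto_intros wx)
    then have "((\<lambda>x. \<bar>w x\<bar> * B) \<longlongrightarrow> 0) (at x within S)"
      using True by simp
    moreover have "\<forall>\<^sub>F y in at x within S. norm (w y * G y) \<le> \<bar>w y\<bar> * B"
      using bd by (auto simp: eventually_at_filter abs_mult intro!: mult_left_mono always_eventually)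
    ultimately show ?thesis
      using True Lim_null_comparison[of "\<lambda>y. w y * G y"] by simp
  next
    case False
    \<comment> \<open>Near \<open>x\<close> all points of \<open>S\<close> satisfy
      \<open>w y \<noteq> 0\<close>, so the limit of \<open>G\<close> within the smaller set is a
      limit within \<open>S\<close>.\<close>
    have "\<forall>\<^sub>F y in at x within S. w y \<noteq> 0"
      using wx False by (rule tendsto_imp_eventually_ne)
    moreover have "(G \<longlongrightarrow> G x) (at x within {x \<in> S. w x \<noteq> 0})"
      using G x False by (auto simp: continuous_on_def)
    ultimately have "(G \<longlongrightarrow> G x) (at x within S)"
      unfolding tendsto_def eventually_at_filter
      by (fast elim: eventually_elim2)
    with wx show ?thesis
      by (rule tendsto_mult)
  qed
qed

text \<open>Dividing by a positive continuous function only rescales the coefficients of a linear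
  relation.\<close>

lemma regular_map_3_bounded:
  assumes "regular_map 3 (Euclidean_space d) N f"
  obtains g where "regular_map 3 (Euclidean_space d) N g" "\<And>x i. \<bar>g x i\<bar> \<le> 1"
proof
  define m where "m = (\<lambda>x. 1 + (\<Sum>j<N. \<bar>f x j\<bar>))"
  \<comment> \<open>The cutoff at \<open>N\<close> makes the bound hold also for \<open>x\<close>
    outside the space, where the coordinates of \<open>f x\<close> from \<open>N\<close> on are
    unconstrained.\<close>
  define g where "g = (\<lambda>x i. if i < N then f x i / m x else 0)"
  have m: "m x > 0" for x
    by (simp add: m_def add_pos_nonneg sum_nonneg)
  have f: "continuous_map (Euclidean_space d) (Euclidean_space N) f"
    using assms by (simp add: regular_map_3_iff)
  have g: "g x i = f x i / m x" if "x \<in> topspace (Euclidean_space d)" for x i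
    using f that by (auto simp: g_def topspace_Euclidean_space continuous_map_def Pi_iff)
  have fi: "continuous_on (topspace (Euclidean_space d)) (\<lambda>x. f x i)" for i
    using f unfolding continuous_map_Euclidean_space_iff_continuous_on
    by (auto intro: continuous_on_product_then_coordinatewise)
  have "continuous_on (topspace (Euclidean_space d)) (\<lambda>x. g x i)" for i
    unfolding g_def using m
    by (cases "i < N") (auto simp: m_def less_imp_neq[symmetric] intro!: continuous_intros fi)
  then have "continuous_map (Euclidean_space d) (Euclidean_space N) g"
    unfolding continuous_map_Euclidean_space_iff_continuous_on
    by (auto intro: continuous_on_coordinatewise_then_product simp: topspace_Euclidean_space g_def)
  moreover have "p = 0 \<and> q = 0 \<and> r = 0"
    if mem: "a \<in> topspace (Euclidean_space d)" "b \<in> topspace (Euclidean_space d)"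
        "c \<in> topspace (Euclidean_space d)"
      and ne: "a \<noteq> b" "a \<noteq> c" "b \<noteq> c"
      and rel: "\<forall>n. p * g a n + q * g b n + r * g c n = 0" for a b c p q r
  proof -
    have "\<forall>n. p / m a * f a n + q / m b * f b n + r / m c * f c n = 0"
      using rel mem by (simp add: g)
    then have "p / m a = 0 \<and> q / m b = 0 \<and> r / m c = 0"
      using assms mem ne unfolding regular_map_3_iff by blast
    then show ?thesis
      using m less_imp_neq by fastforce
  qed
  ultimately show "regular_map 3 (Euclidean_space d) N g"
    unfolding regular_map_3_iff by blast
  show "\<bar>g x i\<bar> \<le> 1" for x i
  proof (cases "i < N")
    case True
    have "\<bar>f x i\<bar> \<le> (\<Sum>j<N. \<bar>f x j\<bar>)"
      using True by (intro member_le_sum) auto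
    then show ?thesis
      using m[of x] True by (simp add: g_def m_def)
  qed (simp add: g_def)
qed

section \<open>Lower bound on the dimension\<close>

lemma regular_map_3_imp_dim_ge:
  assumes d: "d \<ge> 1" and reg: "regular_map 3 (Euclidean_space d) N f"
  shows "N \<ge> d + 2"
proof (rule ccontr)
  assume "\<not> N \<ge> d + 2"
  then have N: "N \<le> Suc d"
    by simp
  obtain g where g: "regular_map 3 (Euclidean_space d) N g" and bd: "\<And>x i. \<bar>g x i\<bar> \<le> 1"
    using regular_map_3_bounded[OF reg] by blast
  let ?E = "topspace (Euclidean_space d)"
  let ?S = "topspace (Euclidean_space (Suc d))"
  define org :: "nat \<Rightarrow> real" where "org = (\<lambda>i. 0)"
  define e :: "real \<Rightarrow> nat \<Rightarrow> real" where "e = (\<lambda>t i. if i = 0 then t else 0)"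
  \<comment> \<open>Here \<open>d \<ge> 1\<close> enters: \<open>e t\<close> uses coordinate 0. For
    \<open>d = 0\<close> there are no three distinct points and regularity is vacuous.\<close>
  have org: "org \<in> ?E" and e: "e t \<in> ?E" for t
    using d by (auto simp: org_def e_def topspace_Euclidean_space)
  have e_eq: "e t = e s \<longleftrightarrow> t = s" for t s
    by (auto simp: e_def fun_eq_iff)
  have e1_neq: "e 1 \<noteq> org"
    by (auto simp: org_def e_def fun_eq_iff)
  have "continuous_map (Euclidean_space d) (Euclidean_space N) g"
    using g by (simp add: regular_map_3_iff)
  then have cont: "continuous_on ?E g" and gN: "\<And>x i. x \<in> ?E \<Longrightarrow> N \<le> i \<Longrightarrow> g x i = 0"
    unfolding continuous_map_Euclidean_space_iff_continuous_on
    by (auto simp: topspace_Euclidean_space)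
  have indep3: "p = 0 \<and> q = 0 \<and> r = 0"
    if "a \<in> ?E" "b \<in> ?E" "c \<in> ?E" "a \<noteq> b" "a \<noteq> c" "b \<noteq> c"
      "\<And>n. p * g a n + q * g b n + r * g c n = 0" for a b c p q r
    using g that unfolding regular_map_3_iff by blast
  have indep2: "p = 0 \<and> q = 0"
    if "a \<in> ?E" "b \<in> ?E" "a \<noteq> b" "\<And>n. p * g a n + q * g b n = 0" for a b p q
  proof -
    \<comment> \<open>A third point with coefficient 0 reduces pairs to triples; of three distinct
      candidates, one avoids both \<open>a\<close> and \<open>b\<close>.\<close>
    have "e 0 \<noteq> e 1" "e 0 \<noteq> e 2" "e 1 \<noteq> e 2"
      by (simp_all add: e_eq)
    then obtain t where "e t \<noteq> a" "e t \<noteq> b"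
      by metis
    then show ?thesis
      using indep3[OF that(1,2) e that(3), of t p q 0] that(4) by simp
  qed
  text \<open>Division by zero gives \<open>u y = 0\<close> when \<open>n y = 0\<close>.\<close>
  define n where "n = (\<lambda>y::nat \<Rightarrow> real. \<Sum>j<d. \<bar>y j\<bar>)"
  define u where "u = (\<lambda>y i. if i < d then y i / n y else 0)"
  \<comment> \<open>The cone over the l1 unit sphere: \<open>n y\<close> is the l1 norm of the first
    \<open>d\<close> coordinates, \<open>u y\<close> the direction, and \<open>y d\<close> the
    height along \<open>g org\<close>.\<close>
  define h where "h = (\<lambda>y i. n y * g (u y) i + y d * g org i)"
  have n0: "n y \<ge> 0" for y
    by (simp add: n_def sum_nonneg)
  have u: "u y \<in> ?E" for y
    by (simp add: u_def topspace_Euclidean_space)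
  have y_eq: "y i = n y * u y i" if "i < d" for y i
  proof (cases "n y = 0")
    case True
    then show ?thesis
      using that by (auto simp: n_def sum_nonneg_eq_0_iff)
  qed (simp add: u_def that)
  have u0: "u y = org \<longleftrightarrow> n y = 0" for y
  proof
    assume "u y = org"
    then have "y j = 0" if "j < d" for j
      using y_eq[OF that, of y] by (simp add: org_def)
    then show "n y = 0"
      by (simp add: n_def)
  qed (simp add: u_def org_def fun_eq_iff)
  have cont_n: "continuous_on S n" for S
    unfolding n_def by (intro continuous_intros continuous_on_coordinate)
  have cont_u: "continuous_on {y \<in> ?S. n y \<noteq> 0} u"
  proof (rule continuous_on_coordinatewise_then_product)
    fix i show "continuous_on {y \<in> ?S. n y \<noteq> 0} (\<lambda>y. u y i)"
      unfolding u_def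
      by (cases "i < d") (auto intro!: continuous_intros continuous_on_coordinate cont_n)
  qed
  have "continuous_on ?S h"
  proof (rule continuous_on_coordinatewise_then_product)
    fix i
    have "continuous_on {y \<in> ?S. n y \<noteq> 0} (\<lambda>y. g (u y))"
      using u by (intro continuous_on_compose2[OF cont cont_u]) auto
    then have "continuous_on {y \<in> ?S. n y \<noteq> 0} (\<lambda>y. g (u y) i)"
      by (rule continuous_on_product_then_coordinatewise)
    then have "continuous_on ?S (\<lambda>y. n y * g (u y) i)"
      by (rule continuous_on_mult_bounded[OF cont_n _ bd])
    then show "continuous_on ?S (\<lambda>y. h y i)"
      unfolding h_def
      by (rule continuous_on_add[OF _ continuous_on_mult_right[OF continuous_on_coordinate]])
  qed
  then have cont_h: "continuous_map (subtopology (Euclidean_space (Suc d)) ?S) (Euclidean_space N) h"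
    unfolding cm_Euclidean_space_iff_continuous_on
    using gN u org by (auto simp: h_def topspace_Euclidean_space)
  have "inj_on h ?S"
  proof (rule inj_onI)
    fix y z assume yz: "y \<in> ?S" "z \<in> ?S" and "h y = h z"
    \<comment> \<open>A relation between the values at \<open>u y\<close>, \<open>u z\<close> and
      \<open>org\<close>; the cases below sort out which of these points coincide.\<close>
    then have rel: "n y * g (u y) i + (- n z) * g (u z) i + (y d - z d) * g org i = 0" for i
      by (auto simp: h_def fun_eq_iff algebra_simps)
    have "n y = n z \<and> u y = u z \<and> y d = z d"
    proof (cases "u y = u z")
      case True
      then have nyz: "n y = 0 \<longleftrightarrow> n z = 0"
        using u0 by metis
      show ?thesis
      proof (cases "n y = 0")
        case True
        \<comment> \<open>On the axis only \<open>org\<close> is left; \<open>e 1\<close> with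
          coefficient 0 is added as the second point.\<close>
        then have "(y d - z d) * g org i + 0 * g (e 1) i = 0" for i
          using rel[of i] nyz by simp
        then have "y d - z d = 0"
          using indep2[OF org e[of 1] e1_neq[symmetric]] by blast
        then show ?thesis
          using True nyz \<open>u y = u z\<close> by simp
      next
        case False
        have "(n y - n z) * g (u y) i + (y d - z d) * g org i = 0" for i
          using rel[of i] True by (simp add: algebra_simps)
        then have "n y - n z = 0 \<and> y d - z d = 0"
          using False u0 indep2[OF u[of y] org] by blast
        then show ?thesis
          using True by simp
      qed
    next
      case False
      \<comment> \<open>Both cannot vanish, since then both directions would be
        \<open>org\<close>.\<close>
      consider "n y = 0" "n z \<noteq> 0" | "n z = 0" "n y \<noteq> 0" | "n y \<noteq> 0" "n z \<noteq> 0"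
        using False u0 by metis
      then show ?thesis
      proof cases
        case 1
        then have "- n z * g (u z) i + (y d - z d) * g org i = 0" for i
          using rel[of i] by simp
        then have "- n z = 0 \<and> y d - z d = 0"
          using 1 u0 indep2[OF u[of z] org] by blast
        with 1 show ?thesis
          by simp
      next
        case 2
        then have "n y * g (u y) i + (y d - z d) * g org i = 0" for i
          using rel[of i] by simp
        then have "n y = 0 \<and> y d - z d = 0"
          using 2 u0 indep2[OF u[of y] org] by blast
        with 2 show ?thesis
          by simp
      next
        case 3
        then show ?thesis
          using indep3[OF u[of y] u[of z] org False _ _ rel] u0 by blast
      qed
    qed
    then have "y i = z i" for i
      using yz y_eq[of i y] y_eq[of i z]
      by (cases i d rule: linorder_cases) (simp_all add: topspace_Euclidean_space)
    then show "y = z"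
      by blast
  qed
  then have "openin (Euclidean_space N) (h ` ?S)"
    \<comment> \<open>The assumption \<open>N \<le> Suc d\<close> is used here: the target has at
      most the dimension of the source.\<close>
    by (intro invariance_of_domain_Euclidean_space_gen[OF N _ cont_h]) auto
  then obtain T where T: "open T" "h ` ?S = topspace (Euclidean_space N) \<inter> T"
    by (subst (asm) Euclidean_space_eq_top_of_set) (auto simp: openin_open)
  \<comment> \<open>A ray starting at \<open>h org = 0\<close> and opposite to
    \<open>g (e 1)\<close>; its points for small \<open>t > 0\<close> stay in the open
    image.\<close>
  define \<gamma> where "\<gamma> = (\<lambda>t i. - t * g (e 1) i)"
  have \<gamma>E: "\<gamma> t \<in> topspace (Euclidean_space N)" for t
    using gN e by (auto simp: \<gamma>_def topspace_Euclidean_space)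
  have "continuous_on UNIV \<gamma>"
    unfolding \<gamma>_def by (intro continuous_on_coordinatewise_then_product continuous_intros)
  then have "open (\<gamma> -` T)"
    using T(1) by (simp add: open_vimage)
  moreover have "org \<in> ?S" "h org = \<gamma> 0"
    by (auto simp: org_def topspace_Euclidean_space h_def \<gamma>_def n_def)
  then have "0 \<in> \<gamma> -` T"
    using T(2) by (metis IntD2 image_eqI vimageI)
  ultimately obtain \<delta> where \<delta>: "\<delta> > 0" "ball 0 \<delta> \<subseteq> \<gamma> -` T"
    by (meson openE)
  define t where "t = \<delta> / 2"
  have "t \<in> ball 0 \<delta>"
    using \<delta>(1) by (simp add: t_def)
  then have t: "\<gamma> t \<in> T" "t > 0"
    using \<delta> by (blast, simp add: t_def)
  then obtain y where "h y = \<gamma> t"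
    using T(2) \<gamma>E by (metis IntI imageE)
  then have rel: "n y * g (u y) i + t * g (e 1) i + y d * g org i = 0" for i
    by (auto simp: h_def \<gamma>_def fun_eq_iff algebra_simps)
  show False
  proof (cases "n y = 0")
    case True
    then have "t * g (e 1) i + y d * g org i = 0" for i
      using rel[of i] by simp
    then have "t = 0"
      using indep2[OF e[of 1] org e1_neq] by blast
    then show False
      using t by simp
  next
    case False
    show False
    proof (cases "u y = e 1")
      case True
      \<comment> \<open>The minus sign in \<open>\<gamma>\<close> matters here: the coefficients of
        \<open>g (e 1)\<close> add up to a positive number instead of cancelling.\<close>
      have "(n y + t) * g (e 1) i + y d * g org i = 0" for i
        using rel[of i] True by (simp add: algebra_simps)
      then have "n y + t = 0"
        using indep2[OF e[of 1] org e1_neq] by blast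
      then show False
        using n0[of y] t by simp
    next
      case neq: False
      have "u y \<noteq> org"
        using False u0 by simp
      then show False
        using indep3[OF u[of y] e[of 1] org neq _ e1_neq rel] t by simp
    qed
  qed
qed

theorem corollary2p2:
  fixes d N :: nat
  assumes "d \<ge> 1"
  shows "(\<exists>f. regular_map 3 (Euclidean_space d) N f) \<longleftrightarrow> N \<ge> d + 2"
  using assms regular_map_3_paraboloid regular_map_3_imp_dim_ge by blast

end
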